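(* For every infinite cardinal $\kappa$ and set $V$ of cardinality $\kappa$, we have $\log_2(\kappa) \leq h_{\mathrm{Lin}} (\vert V\vert ) \leq d(\mathrm{Lin} (V))\leq \delta(\kappa)$.
   Context: $\log_2(\kappa)$ is the least cardinal $\mu$ with $\kappa\le 2^\mu$. $\mathrm{Lin}(V)$ is the set of linear orders on $V$, each identified with a subset of $V\times V\setminus\Delta_V$, with the topology induced by the product topology on $\mathcal P(V\times V\setminus\Delta_V)$; $d(\mathrm{Lin}(V))$ is its density character (minimum cardinality of a dense subset). $h_{\mathrm{Lin}}(\vert V\vert)$ is the least cardinality of a family of linear orders on $V$ such that any two distinct ordered pairs $(x,y),(x',y')$ of distinct elements of $V$ are separated by some member $\ell$ ($\ell(x,y)\ne\ell(x',y')$, where $\ell(x,y)=1$ iff $x<_\ell y$). $\delta(\kappa)$ is the least cardinal $\mu$ such that there is a linear order on a set of cardinality $\kappa$ admitting a dense subset (for the interval topology of that order) of cardinality $\mu$. *)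

theory Defs
  imports "HOL-Analysis.Analysis"
begin

unbundle cardinal_syntax
no_notation elt_set_eq (infix "=o" 50)

text \<open>
  Cardinals are the cardinal orders (\<^const>\<open>Card_order\<close>) of the library, compared across types by
  \<open>\<le>o\<close> and \<open>=o\<close>. The least cardinal with property \<open>P\<close> is determined up to \<open>=o\<close>
  as soon as some cardinal on the type in question satisfies \<open>P\<close>. In each use below a
  minimum over all cardinals is attained on that type, so restricting the minimum to cardinals on
  the type is harmless.
\<close>

definition least_cardinal :: "('b rel \<Rightarrow> bool) \<Rightarrow> 'b rel" where
  "least_cardinal P =
     (SOME \<mu>. Card_order \<mu> \<and> P \<mu> \<and> (\<forall>\<nu>. Card_order \<nu> \<and> P \<nu> \<longrightarrow> \<mu> \<le>o \<nu>))"

lemma least_cardinal_props: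
  assumes "Card_order \<mu>" "P \<mu>"
  shows "Card_order (least_cardinal P)" "P (least_cardinal P)"
    and "\<And>\<nu>. Card_order \<nu> \<Longrightarrow> P \<nu> \<Longrightarrow> least_cardinal P \<le>o \<nu>"
proof -
  have "\<exists>\<mu>. Card_order \<mu> \<and> P \<mu> \<and> (\<forall>\<nu>. Card_order \<nu> \<and> P \<nu> \<longrightarrow> \<mu> \<le>o \<nu>)"
    using exists_minim_Card_order[of "{\<nu>. Card_order \<nu> \<and> P \<nu>}"] assms by blast
  from someI_ex[OF this]
  have *: "Card_order (least_cardinal P) \<and> P (least_cardinal P)
      \<and> (\<forall>\<nu>. Card_order \<nu> \<and> P \<nu> \<longrightarrow> least_cardinal P \<le>o \<nu>)"
    unfolding least_cardinal_def .
  show "Card_order (least_cardinal P)" "P (least_cardinal P)"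
    "\<And>\<nu>. Card_order \<nu> \<Longrightarrow> P \<nu> \<Longrightarrow> least_cardinal P \<le>o \<nu>"
    using * by auto
qed

definition log2 :: "'k rel \<Rightarrow> 'k rel" where
  "log2 \<kappa> = least_cardinal (\<lambda>\<mu>. \<kappa> \<le>o ctwo ^c \<mu>)"

definition Lin :: "'a set \<Rightarrow> ('a \<times> 'a) set set" where
  "Lin V = {l. l \<subseteq> V \<times> V - Id \<and> strict_linear_order_on V l}"

lemma Lin_eq_diff_Id: "Lin V = {r - Id | r. linear_order_on V r}"
proof -
  have "l \<in> {r - Id | r. linear_order_on V r}" if "l \<in> Lin V" for l
  proof -
    have l: "l \<subseteq> V \<times> V - Id" "trans l" "irrefl l" "total_on V l"
      using that by (auto simp: Lin_def strict_linear_order_on_def)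
    have "linear_order_on V (l \<union> Id_on V)"
      unfolding order_on_defs
    proof (intro conjI)
      show "trans (l \<union> Id_on V)" using l(2) unfolding trans_def by blast
      show "antisym (l \<union> Id_on V)"
        using l(2,3) unfolding antisym_def trans_def irrefl_def by blast
    qed (use l in \<open>auto simp: refl_on_def total_on_def\<close>)
    moreover have "l = (l \<union> Id_on V) - Id" using l(1) by auto
    ultimately show ?thesis by blast
  qed
  moreover have "r - Id \<in> Lin V" if "linear_order_on V r" for r
    using strict_linear_order_on_diff_Id[OF that] that
    by (auto simp: Lin_def order_on_defs)
  ultimately show ?thesis by blast
qed

text \<open>The topology on \<^term>\<open>Pow X\<close> obtained by identifying subsets of \<open>X\<close> with their characteristic
  functions in the product of \<open>X\<close> copies of the discrete two-point space.\<close>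

definition powerset_topology :: "'a set \<Rightarrow> 'a set topology" where
  "powerset_topology X =
     pullback_topology (Pow X) (\<lambda>S. \<lambda>x\<in>X. x \<in> S)
       (product_topology (\<lambda>_. discrete_topology (UNIV :: bool set)) X)"

definition Lin_topology :: "'a set \<Rightarrow> ('a \<times> 'a) set topology" where
  "Lin_topology V = subtopology (powerset_topology (V \<times> V - Id)) (Lin V)"

lemma topspace_powerset_topology [simp]: "topspace (powerset_topology X) = Pow X"
  by (auto simp: powerset_topology_def topspace_pullback_topology)

lemma topspace_Lin_topology [simp]: "topspace (Lin_topology V) = Lin V"
  by (auto simp: Lin_topology_def Lin_def)

definition dense_subset :: "'a topology \<Rightarrow> 'a set \<Rightarrow> bool" where
  "dense_subset T D \<longleftrightarrow> D \<subseteq> topspace T \<and> T closure_of D = topspace T"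

definition density_character :: "'a topology \<Rightarrow> 'a rel" where
  "density_character T = least_cardinal (\<lambda>\<mu>. \<exists>D. dense_subset T D \<and> |D| =o \<mu>)"

definition separates_pairs :: "'a set \<Rightarrow> ('a \<times> 'a) set set \<Rightarrow> bool" where
  "separates_pairs V F \<longleftrightarrow>
     (\<forall>p \<in> V \<times> V - Id. \<forall>q \<in> V \<times> V - Id. p \<noteq> q \<longrightarrow> (\<exists>l\<in>F. (p \<in> l) \<noteq> (q \<in> l)))"

definition h_Lin :: "'a set \<Rightarrow> ('a \<times> 'a) set rel" where
  "h_Lin V = least_cardinal (\<lambda>\<mu>. \<exists>F. F \<subseteq> Lin V \<and> separates_pairs V F \<and> |F| =o \<mu>)"

text \<open>The open rays form a subbase; the carrier is added for the sake of one-point orders.\<close>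

definition interval_topology :: "'a set \<Rightarrow> 'a rel \<Rightarrow> 'a topology" where
  "interval_topology X r = topology_generated_by
     (insert X ((\<lambda>a. {x \<in> X. (x, a) \<in> r - Id}) ` X \<union> (\<lambda>a. {x \<in> X. (a, x) \<in> r - Id}) ` X))"

lemma topspace_interval_topology [simp]: "topspace (interval_topology X r) = X"
  by (auto simp: interval_topology_def)

definition delta :: "'k rel \<Rightarrow> 'k rel" where
  "delta \<kappa> = least_cardinal (\<lambda>\<mu>. \<exists>(X :: 'k set) r D. |X| =o \<kappa> \<and> linear_order_on X r
     \<and> dense_subset (interval_topology X r) D \<and> |D| =o \<mu>)"

text \<open>\<^const>\<open>log2\<close> and \<^const>\<open>delta\<close> are minimal also among the cardinals and orders on
  other types.\<close>

lemma log2_props: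
  assumes "Card_order \<kappa>"
  shows "Card_order (log2 \<kappa>)" "\<kappa> \<le>o ctwo ^c log2 \<kappa>"
    and "\<And>\<mu> :: 'b rel. Card_order \<mu> \<Longrightarrow> \<kappa> \<le>o ctwo ^c \<mu> \<Longrightarrow> log2 \<kappa> \<le>o \<mu>"
proof -
  have k: "\<kappa> \<le>o ctwo ^c \<kappa>" 
    using assms by (simp add: ordLess_imp_ordLeq ordLess_ctwo_cexp)
  note lc = least_cardinal_props[where P = "\<lambda>\<mu>. \<kappa> \<le>o ctwo ^c \<mu>", OF assms k, folded log2_def]
  show "Card_order (log2 \<kappa>)" "\<kappa> \<le>o ctwo ^c log2 \<kappa>" by (fact lc)+
  fix \<mu> :: "'b rel" assume m: "Card_order \<mu>" "\<kappa> \<le>o ctwo ^c \<mu>"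
  show "log2 \<kappa> \<le>o \<mu>"
  proof (cases "\<kappa> \<le>o \<mu>")
    case True
    then show ?thesis using lc(3)[OF assms k] ordLeq_transitive by blast
  next
    case False
    have wo: "Well_order \<kappa>" "Well_order \<mu>"
      using assms m(1) by (simp_all add: card_order_on_def)
    then have "\<mu> \<le>o \<kappa>" using False ordLeq_total[OF wo] by simp
    then have "|Field \<mu>| \<le>o |Field \<kappa>|" by (rule card_of_mono2)
    then obtain f where f: "inj_on f (Field \<mu>)" "f ` Field \<mu> \<subseteq> Field \<kappa>"
      by (subst (asm) card_of_ordLeq[symmetric]) blast
    have "|Field \<mu>| =o |f ` Field \<mu>|"
      by (rule card_of_ordIsoI[OF bij_betw_imageI[OF f(1) refl]])
    then have i: "\<mu> =o |f ` Field \<mu>|"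
      by (rule ordIso_transitive[OF ordIso_symmetric[OF card_of_Field_ordIso[OF m(1)]]])
    have "ctwo ^c \<mu> =o ctwo ^c |f ` Field \<mu>|"
      by (rule cexp_cong2[OF i Card_order_ctwo m(1)])
    with m(2) have "\<kappa> \<le>o ctwo ^c |f ` Field \<mu>|" by (rule ordLeq_ordIso_trans)
    then have "log2 \<kappa> \<le>o |f ` Field \<mu>|" by (rule lc(3)[OF card_of_Card_order])
    then show ?thesis by (rule ordLeq_ordIso_trans[OF _ ordIso_symmetric[OF i]])
  qed
qed

lemma delta_le:
  fixes \<kappa> :: "'k rel" and X :: "'x set"
  assumes "Card_order \<kappa>" "|X| =o \<kappa>" "linear_order_on X r"
    and D: "dense_subset (interval_topology X r) D"
  shows "delta \<kappa> \<le>o |D|"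
proof -
  have "|X| =o |Field \<kappa>|"
    using assms(1,2) card_of_Field_ordIso ordIso_symmetric ordIso_transitive by blast
  then obtain f where f: "bij_betw f X (Field \<kappa>)" using card_of_ordIso by blast
  then have inj: "inj_on f X" and im: "f ` X = Field \<kappa>" by (auto simp: bij_betw_def)
  define s where "s = map_prod f f ` r"
  have rX: "r \<subseteq> X \<times> X" using assms(3) by (simp add: order_on_defs)
  have s_iff: "(f x, f y) \<in> s \<longleftrightarrow> (x, y) \<in> r" if "x \<in> X" "y \<in> X" for x y
    using that rX inj unfolding s_def by (auto dest: inj_onD)
  have sK: "s \<subseteq> f ` X \<times> f ` X" using rX unfolding s_def by auto
  have "linear_order_on (f ` X) s"
    unfolding order_on_defs
  proof (intro conjI)
    show "s \<subseteq> f ` X \<times> f ` X" by (fact sK)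
    show "refl_on (f ` X) s"
      using assms(3) by (auto simp: refl_on_def order_on_defs s_iff)
    show "trans s"
    proof (rule transI)
      fix x y z assume a: "(x, y) \<in> s" "(y, z) \<in> s"
      then obtain x' y' z' where "x = f x'" "y = f y'" "z = f z'" "x' \<in> X" "y' \<in> X" "z' \<in> X"
        using sK by blast
      moreover have "trans r" using assms(3) by (simp add: order_on_defs)
      ultimately show "(x, z) \<in> s" using a by (auto simp: s_iff dest: transD)
    qed
    show "antisym s"
    proof (rule antisymI)
      fix x y assume a: "(x, y) \<in> s" "(y, x) \<in> s"
      then obtain x' y' where "x = f x'" "y = f y'" "x' \<in> X" "y' \<in> X"
        using sK by blast
      moreover have "antisym r" using assms(3) by (simp add: order_on_defs)
      ultimately show "x = y" using a by (auto simp: s_iff dest: antisymD)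
    qed
    show "total_on (f ` X) s"
      using assms(3) by (fastforce simp: total_on_def order_on_defs s_iff)
  qed
  moreover have cont: "continuous_map (interval_topology X r) (interval_topology (f ` X) s) f"
    unfolding interval_topology_def[of "f ` X"]
  proof (rule continuous_on_generated_topo)
    fix U assume "U \<in> insert (f ` X) ((\<lambda>a. {x \<in> f ` X. (x, a) \<in> s - Id}) ` f ` X
        \<union> (\<lambda>a. {x \<in> f ` X. (a, x) \<in> s - Id}) ` f ` X)"
    then consider "U = f ` X" | a where "a \<in> X" "U = {x \<in> f ` X. (x, f a) \<in> s - Id}"
      | a where "a \<in> X" "U = {x \<in> f ` X. (f a, x) \<in> s - Id}"
      by (elim insertE UnE imageE) (hypsubst, blast)+
    then show "openin (interval_topology X r) (f -` U \<inter> topspace (interval_topology X r))"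
    proof cases
      case 1
      then have "f -` U \<inter> X = X" by auto
      then show ?thesis using openin_topspace[of "interval_topology X r"] by simp
    next
      case 2
      then have eq: "f -` U \<inter> X = {x \<in> X. (x, a) \<in> r - Id}"
        using inj by (auto simp: s_iff inj_on_eq_iff)
      have "openin (interval_topology X r) {x \<in> X. (x, a) \<in> r - Id}"
        unfolding interval_topology_def
        by (rule topology_generated_by_Basis, rule insertI2, rule UnI1, rule imageI, rule 2(1))
      then show ?thesis by (simp only: topspace_interval_topology eq)
    next
      case 3
      then have eq: "f -` U \<inter> X = {x \<in> X. (a, x) \<in> r - Id}"
        using inj by (auto simp: s_iff inj_on_eq_iff)
      have "openin (interval_topology X r) {x \<in> X. (a, x) \<in> r - Id}"
        unfolding interval_topology_def
        by (rule topology_generated_by_Basis, rule insertI2, rule UnI2, rule imageI, rule 3(1))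
      then show ?thesis by (simp only: topspace_interval_topology eq)
    qed
  qed auto
  have DX: "D \<subseteq> X" using D by (simp add: dense_subset_def)
  have "dense_subset (interval_topology (f ` X) s) (f ` D)"
    unfolding dense_subset_def
  proof
    show "f ` D \<subseteq> topspace (interval_topology (f ` X) s)" using DX by auto
    have "f ` X \<subseteq> interval_topology (f ` X) s closure_of f ` D"
      using continuous_map_image_closure_subset[OF cont, of D] D by (simp add: dense_subset_def)
    then show "interval_topology (f ` X) s closure_of f ` D
        = topspace (interval_topology (f ` X) s)"
      using closure_of_subset_topspace[of "interval_topology (f ` X) s" "f ` D"] by simp
  qed
  moreover have "|f ` X| =o \<kappa>" using assms(1) by (simp add: im card_of_Field_ordIso)
  ultimately have "delta \<kappa> \<le>o |f ` D|"
    unfolding delta_def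
    by (intro least_cardinal_props(3)[of "|f ` D|"] card_of_Card_order) (blast intro: card_of_refl)+
  then show ?thesis using card_of_image ordLeq_transitive by blast
qed

end

theory Submission
  imports Defs
begin

text \<open>
  A family \<open>F\<close> separating pairs embeds \<open>V \<times> V - Id\<close> into the power set of \<open>F\<close>, and a dense set
  of linear orders separates pairs because any two distinct pairs are separated by a nonempty open set.

  For the last inequality, suppose that a family \<open>\<T>\<close> of subsets of \<open>V\<close> separates points. Ranking the
  points by finitely many finite intersections of members of \<open>\<T>\<close>, with ties broken by one fixed linear
  order, realises every finite pattern of a linear order, so these rank orders are dense.
  If \<open>D\<close> is dense in a linearly ordered \<open>X\<close>, the open upper rays of the points of \<open>D\<close> separate all points
  except the two ends of certain jumps. The upper end of such a jump has an immediate predecessor;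
  the lower end has none, since otherwise it would be isolated and hence in \<open>D\<close>. So one more set, that of
  the points with an immediate predecessor, suffices.
\<close>

section \<open>Linear orders obtained from rank functions\<close>

lemma Lin_nonempty: "\<exists>l. l \<in> Lin V"
proof -
  obtain r where "well_order_on V r" using well_order_on by blast
  then have "linear_order_on V r" by (simp add: well_order_on_def)
  then show ?thesis by (auto simp: Lin_eq_diff_Id)
qed

lemma LinD:
  assumes "l \<in> Lin V"
  shows "l \<subseteq> V \<times> V" "\<And>x. (x, x) \<notin> l"
    "\<And>x y z. (x, y) \<in> l \<Longrightarrow> (y, z) \<in> l \<Longrightarrow> (x, z) \<in> l"
    "\<And>x y. x \<in> V \<Longrightarrow> y \<in> V \<Longrightarrow> x \<noteq> y \<Longrightarrow> (x, y) \<in> l \<or> (y, x) \<in> l"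
    "\<And>x y. (x, y) \<in> l \<Longrightarrow> (y, x) \<notin> l"
  using assms unfolding Lin_def strict_linear_order_on_def total_on_def irrefl_def
  by (auto dest: transD)

text \<open>The tie-breaker \<open>b\<close> makes every rank function yield a linear order once
  \<open>b\<close> is in \<open>Lin V\<close>. A few ranks can thus be prescribed without any
  injectivity.\<close>

definition lex_order :: "'a set \<Rightarrow> 'a rel \<Rightarrow> ('a \<Rightarrow> nat) \<Rightarrow> 'a rel" where
  "lex_order V b f = {(x, y) \<in> V \<times> V. f x < f y \<or> f x = f y \<and> (x, y) \<in> b}"

lemma lex_order_Lin:
  assumes "b \<in> Lin V"
  shows "lex_order V b f \<in> Lin V"
proof -
  note b = LinD[OF assms]
  have "trans (lex_order V b f)"
    unfolding lex_order_def by (rule transI) (auto intro: b(3))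
  moreover have "irrefl (lex_order V b f)"
    using b(2) by (auto simp: irrefl_def lex_order_def)
  moreover have "total_on V (lex_order V b f)"
    using b(4) unfolding total_on_def lex_order_def by (auto simp: neq_iff)
  ultimately show ?thesis
    unfolding Lin_def strict_linear_order_on_def by (auto simp: lex_order_def irrefl_def)
qed

text \<open>Three ranks suffice. If the pairs share their first coordinate \<open>x\<close>, then
  \<open>y'\<close> goes to the bottom, \<open>y\<close> to the top and all else between. Otherwise
  \<open>x\<close> goes to the bottom and \<open>x'\<close> to the top, which also covers a reversed
  pair.\<close>

lemma Lin_separates_two:
  assumes p: "p \<in> V \<times> V - Id" and q: "q \<in> V \<times> V - Id" and "p \<noteq> q"
  shows "\<exists>l \<in> Lin V. p \<in> l \<and> q \<notin> l"
proof -
  obtain x y x' y' where pq: "p = (x, y)" "q = (x', y')" by (cases p, cases q)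
  have V: "x \<in> V" "y \<in> V" "x' \<in> V" "y' \<in> V" "x \<noteq> y" "x' \<noteq> y'" using p q pq by auto
  obtain b where b: "b \<in> Lin V" using Lin_nonempty by blast
  have "\<exists>f :: 'a \<Rightarrow> nat. f x < f y \<and> f y' < f x'"
  proof (cases "x = x'")
    case True
    then have "y \<noteq> y'" using \<open>p \<noteq> q\<close> pq by auto
    then show ?thesis using V True
      by (intro exI[of _ "\<lambda>v. if v = y' then 0 else if v = y then 2 else 1"]) auto
  next
    case False
    then show ?thesis using V
      by (intro exI[of _ "\<lambda>v. if v = x then 0 else if v = x' then 2 else 1"]) auto
  qed
  then obtain f :: "'a \<Rightarrow> nat" where "f x < f y" "f y' < f x'" by blast
  then show ?thesis
    using lex_order_Lin[OF b, of f] V pq by (intro bexI) (auto simp: lex_order_def)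
qed

section \<open>Open sets of linear orders as finite patterns\<close>

lemma openin_powerset_topology_member:
  assumes "p \<in> X"
  shows "openin (powerset_topology X) {S \<in> Pow X. (p \<in> S) = c}"
proof -
  have "openin (product_topology (\<lambda>_. discrete_topology (UNIV :: bool set)) X)
      {g \<in> topspace (product_topology (\<lambda>_. discrete_topology (UNIV :: bool set)) X). g p \<in> {c}}"
    by (rule openin_continuous_map_preimage[OF continuous_map_product_projection[OF assms]]) simp
  then show ?thesis
    unfolding powerset_topology_def openin_pullback_topology using assms
    by (intro exI conjI) (assumption, auto)
qed

lemma openin_Lin_topology_member:
  assumes "p \<in> V \<times> V - Id"
  shows "openin (Lin_topology V) {l \<in> Lin V. (p \<in> l) = c}"
proof -
  have "{l \<in> Lin V. (p \<in> l) = c} = {S \<in> Pow (V \<times> V - Id). (p \<in> S) = c} \<inter> Lin V"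
    by (auto simp: Lin_def)
  then show ?thesis
    unfolding Lin_topology_def openin_subtopology
    using openin_powerset_topology_member[OF assms] by blast
qed

text \<open>A basic box of the product constrains only finitely many coordinates, and these form
  \<open>K\<close>. Density thus reduces to matching a given order on finitely many pairs.\<close>

lemma openin_Lin_topologyD:
  assumes "openin (Lin_topology V) U" "l \<in> U"
  shows "\<exists>K. finite K \<and> K \<subseteq> V \<times> V - Id \<and> (\<forall>l' \<in> Lin V. (\<forall>p \<in> K. p \<in> l' \<longleftrightarrow> p \<in> l) \<longrightarrow> l' \<in> U)"
proof -
  let ?X = "V \<times> V - Id"
  let ?c = "\<lambda>S. \<lambda>x\<in>?X. x \<in> S"
  obtain W where W: "openin (product_topology (\<lambda>_. discrete_topology (UNIV :: bool set)) ?X) W"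
    and U: "U = ?c -` W \<inter> Pow ?X \<inter> Lin V"
    using assms(1) unfolding Lin_topology_def openin_subtopology powerset_topology_def
      openin_pullback_topology by blast
  have "?c l \<in> W" using U assms(2) by auto
  then obtain B where B: "finite {i \<in> ?X. B i \<noteq> UNIV}" "?c l \<in> Pi\<^sub>E ?X B" "Pi\<^sub>E ?X B \<subseteq> W"
    using W unfolding openin_product_topology_alt by (auto 0 3)
  show ?thesis
  proof (intro exI[of _ "{i \<in> ?X. B i \<noteq> UNIV}"] conjI ballI impI)
    fix l' assume l': "l' \<in> Lin V" "\<forall>p \<in> {i \<in> ?X. B i \<noteq> UNIV}. p \<in> l' \<longleftrightarrow> p \<in> l"
    have "?c l' \<in> Pi\<^sub>E ?X B"
    proof (rule PiE_I)
      fix p assume p: "p \<in> ?X"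
      then have "(p \<in> l) \<in> B p" using B(2) by (auto dest: PiE_mem)
      moreover have "p \<in> l' \<longleftrightarrow> p \<in> l" if "B p \<noteq> UNIV" using l'(2) p that by blast
      ultimately show "?c l' p \<in> B p" using p by (cases "B p = UNIV") auto
    qed auto
    then have "?c l' \<in> W" using B(3) by blast
    moreover have "l' \<in> Pow ?X" using l'(1) by (simp add: Lin_def)
    ultimately show "l' \<in> U" using U l'(1) by blast
  qed (use B(1) in auto)
qed

section \<open>Separation of pairs and the lower bounds\<close>

lemma dense_separates_pairs:
  assumes "dense_subset (Lin_topology V) D"
  shows "D \<subseteq> Lin V" "separates_pairs V D"
proof -
  show "D \<subseteq> Lin V" using assms by (simp add: dense_subset_def)
  have meets: "D \<inter> U \<noteq> {}" if "openin (Lin_topology V) U" "U \<noteq> {}" for U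
    using assms that unfolding dense_subset_def dense_intersects_open by blast
  show "separates_pairs V D"
    unfolding separates_pairs_def
  proof (intro ballI impI)
    fix p q assume pq: "p \<in> V \<times> V - Id" "q \<in> V \<times> V - Id" "p \<noteq> q"
    let ?U = "{l \<in> Lin V. (p \<in> l) = True} \<inter> {l \<in> Lin V. (q \<in> l) = False}"
    have "openin (Lin_topology V) ?U"
      by (intro openin_Int openin_Lin_topology_member pq)
    moreover have "?U \<noteq> {}" using Lin_separates_two[OF pq] by auto
    ultimately have "D \<inter> ?U \<noteq> {}" by (rule meets)
    then show "\<exists>l\<in>D. (p \<in> l) \<noteq> (q \<in> l)" by auto
  qed
qed

text \<open>Pairs with one fixed first coordinate \<open>a\<close> are enough: \<open>v\<close> is
  determined by the members of \<open>F\<close> that place it above \<open>a\<close>. Removing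
  \<open>a\<close> from \<open>V\<close> leaves an infinite cardinality unchanged.\<close>

lemma card_of_le_ctwo_cexp_separating:
  assumes "infinite V" "separates_pairs V F"
  shows "|V| \<le>o ctwo ^c |F|"
proof -
  obtain a where a: "a \<in> V" using assms(1) by fastforce
  have "|V| =o |V - {a}|"
    using infinite_imp_bij_betw[OF assms(1)] card_of_ordIso by blast
  moreover have "|V - {a}| \<le>o |Pow F|"
  proof (rule card_of_ordLeq[THEN iffD1], intro exI conjI)
    show "inj_on (\<lambda>v. {l \<in> F. (a, v) \<in> l}) (V - {a})"
    proof (rule inj_onI, rule ccontr)
      fix v w assume vw: "v \<in> V - {a}" "w \<in> V - {a}" "v \<noteq> w"
        and eq: "{l \<in> F. (a, v) \<in> l} = {l \<in> F. (a, w) \<in> l}"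
      have "(a, v) \<in> V \<times> V - Id" "(a, w) \<in> V \<times> V - Id" "(a, v) \<noteq> (a, w)" using vw a by auto
      then obtain l where "l \<in> F" "((a, v) \<in> l) \<noteq> ((a, w) \<in> l)"
        using assms(2) unfolding separates_pairs_def by blast
      then show False using eq by blast
    qed
  qed auto
  moreover have "|Pow F| =o ctwo ^c |F|"
    unfolding ctwo_def cexp_def Field_card_of by (rule card_of_Pow_Func)
  ultimately show ?thesis
    using ordIso_ordLeq_trans ordLeq_ordIso_trans by blast
qed

section \<open>Dense sets of orders from point-separating families\<close>

lemma card_of_ordLeq_finite_infinite: "finite A \<Longrightarrow> infinite B \<Longrightarrow> |A| \<le>o |B|"
  by (intro ordLess_imp_ordLeq finite_ordLess_infinite card_of_Well_order) (simp_all add: Field_card_of)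

text \<open>Lists are split by length: each length contributes at most \<open>|J|\<close> by
  absorption of products, and there are only countably many lengths. Applied twice, this bounds the
  number of rank orders.\<close>

lemma card_of_lists_le:
  assumes "infinite J" "|A| \<le>o |J|"
  shows "|lists A| \<le>o |J|"
proof -
  let ?L = "\<lambda>n. {xs \<in> lists A. length xs = n}"
  have "|?L n| \<le>o |J|" for n
  proof (induction n)
    case 0
    have "?L 0 = {[]}" by auto
    then show ?case using assms(1) by (simp add: card_of_ordLeq_finite_infinite)
  next
    case (Suc n)
    have "?L (Suc n) \<subseteq> (\<lambda>(x, xs). x # xs) ` (A \<times> ?L n)"
      by (auto simp: length_Suc_conv)
    then have "|?L (Suc n)| \<le>o |A \<times> ?L n|"
      by (rule ordLeq_transitive[OF card_of_mono1 card_of_image])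
    also have "|A \<times> ?L n| \<le>o |J|"
      by (rule card_of_Times_ordLeq_infinite_Field)
        (use assms Suc in \<open>simp_all only: Field_card_of card_of_card_order_on not_False_eq_True\<close>)
    finally show ?case .
  qed
  then have "|\<Union>n\<in>UNIV. ?L n| \<le>o |J|"
    using assms(1) by (intro card_of_UNION_ordLeq_infinite)
      (simp_all only: infinite_iff_card_of_nat simp_thms ball_simps)
  moreover have "(\<Union>n\<in>UNIV. ?L n) = lists A" by auto
  ultimately show ?thesis by simp
qed

lemma Lin_sorted_list:
  assumes "l \<in> Lin V" "finite F" "F \<subseteq> V"
  shows "\<exists>xs. set xs = F \<and> sorted_wrt (\<lambda>x y. (x, y) \<in> l) xs"
  using assms(2,3)
proof (induction F rule: finite_remove_induct)
  case empty
  then show ?case by (intro exI[of _ "[]"]) simp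
next
  case (remove F)
  note l = LinD[OF assms(1)]
  have "\<exists>m\<in>F. \<forall>x\<in>F. x \<noteq> m \<longrightarrow> (x, m) \<notin> l"
    using remove(1,2) by (intro Finite_Set.bex_min_element)
      (auto intro!: asymp_onI transp_onI dest: l(3,5))
  then obtain m where m: "m \<in> F" "\<And>x. x \<in> F \<Longrightarrow> x \<noteq> m \<Longrightarrow> (x, m) \<notin> l" by blast
  then obtain xs where xs: "set xs = F - {m}" "sorted_wrt (\<lambda>x y. (x, y) \<in> l) xs"
    using remove by blast
  \<comment> \<open>Totality turns the minimal element into the least one, so it can head the
    list.\<close>
  have "(m, x) \<in> l" if "x \<in> F" "x \<noteq> m" for x
    using l(4)[of m x] m that remove.prems by blast
  then show ?case
    using xs m(1) by (intro exI[of _ "m # xs"]) auto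
qed

text \<open>Each inner list encodes a cell, the intersection of its members; the empty list encodes
  the whole type. Points in no cell all receive the rank \<open>length cs\<close>. Coding by lists
  keeps the set of parameters small.\<close>

definition cell_index :: "'a set list list \<Rightarrow> 'a \<Rightarrow> nat" where
  "cell_index cs x = length (takeWhile (\<lambda>c. x \<notin> \<Inter>(set c)) cs)"

text \<open>Among the listed points, the cell of \<open>v\<close> contains only \<open>v\<close>, so
  the rank of a listed point is its position in the list. Cells may overlap elsewhere.\<close>

lemma cell_index_strict_mono:
  assumes "sorted_wrt R xs" "x \<in> set xs" "y \<in> set xs" "R x y" "\<And>u v. R u v \<Longrightarrow> \<not> R v u"
    and "\<And>u v. u \<in> set xs \<Longrightarrow> v \<in> set xs \<Longrightarrow> u \<in> \<Inter>(set (c v)) \<longleftrightarrow> u = v"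
  shows "cell_index (map c xs) x < cell_index (map c xs) y"
  using assms(1-3,6)
proof (induction xs)
  case (Cons a xs)
  \<comment> \<open>If \<open>y\<close> were the head, \<open>x\<close> would either equal it or
    come after it; asymmetry of \<open>R\<close> excludes both.\<close>
  have "y \<noteq> a"
    using Cons.prems(1,2) assms(4) assms(5) by auto
  then have y: "cell_index (map c (a # xs)) y = Suc (cell_index (map c xs) y)"
    using Cons.prems(3,4) by (auto simp: cell_index_def)
  show ?case
  proof (cases "x = a")
    case True
    then have "cell_index (map c (a # xs)) x = 0"
      using Cons.prems(4)[of a a] by (simp add: cell_index_def)
    then show ?thesis using y by simp
  next
    case False
    then have "cell_index (map c (a # xs)) x = Suc (cell_index (map c xs) x)"
      using Cons.prems(2,4) by (auto simp: cell_index_def)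
    moreover have "cell_index (map c xs) x < cell_index (map c xs) y"
      using Cons False \<open>y \<noteq> a\<close> by (intro Cons.IH) auto
    ultimately show ?thesis using y by simp
  qed
qed simp

lemma dense_Lin_of_separating_family:
  fixes J :: "'j set"
  assumes "infinite J" "|\<T>| \<le>o |J|"
    and sep: "\<And>x y. x \<in> V \<Longrightarrow> y \<in> V \<Longrightarrow> x \<noteq> y \<Longrightarrow> \<exists>T\<in>\<T>. x \<in> T \<and> y \<notin> T"
  shows "\<exists>E. dense_subset (Lin_topology V) E \<and> |E| \<le>o |J|"
proof -
  obtain b where b: "b \<in> Lin V" using Lin_nonempty by blast
  \<comment> \<open>The order \<open>b\<close> is fixed once and only the list of cells varies,
    which gives the cardinality bound.\<close>
  let ?E = "(\<lambda>cs. lex_order V b (cell_index cs)) ` lists (lists \<T>)"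
  have "|?E| \<le>o |J|"
    using card_of_lists_le[OF assms(1) card_of_lists_le[OF assms(1,2)]] card_of_image
      ordLeq_transitive by blast
  moreover have "?E \<inter> U \<noteq> {}" if U: "openin (Lin_topology V) U" "U \<noteq> {}" for U
  proof -
    obtain l where lU: "l \<in> U" using U by auto
    have l: "l \<in> Lin V" using openin_subset[OF U(1)] lU by auto
    note lD = LinD[OF l]
    obtain K where K: "finite K" "K \<subseteq> V \<times> V - Id"
      "\<And>l'. l' \<in> Lin V \<Longrightarrow> \<forall>p\<in>K. p \<in> l' \<longleftrightarrow> p \<in> l \<Longrightarrow> l' \<in> U"
      using openin_Lin_topologyD[OF U(1) lU] by blast
    define F where "F = fst ` K \<union> snd ` K"
    have F: "finite F" "F \<subseteq> V" using K(1,2) by (auto simp: F_def)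
    obtain xs where xs: "set xs = F" "sorted_wrt (\<lambda>x y. (x, y) \<in> l) xs"
      using Lin_sorted_list[OF l F] by blast
    \<comment> \<open>For each other point of \<open>F\<close>, take one member of the family that
      contains \<open>v\<close> and omits that point. The intersection of these members meets
      \<open>F\<close> only in \<open>v\<close>.\<close>
    have "\<exists>c \<in> lists \<T>. \<forall>u \<in> F. u \<in> \<Inter>(set c) \<longleftrightarrow> u = v" if v: "v \<in> F" for v
    proof -
      obtain T where T: "\<And>u. u \<in> F - {v} \<Longrightarrow> T u \<in> \<T> \<and> v \<in> T u \<and> u \<notin> T u"
        using sep[of v] v F(2) by (metis DiffE insertI1 subsetD)
      obtain c where "set c = T ` (F - {v})"
        using finite_list[of "T ` (F - {v})"] F(1) by blast
      moreover have "c \<in> lists \<T>" using calculation T by (auto simp: in_lists_conv_set)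
      moreover have "u \<in> \<Inter>(set c) \<longleftrightarrow> u = v" if "u \<in> F" for u
        using calculation(1) T that by blast
      ultimately show ?thesis by blast
    qed
    then obtain c where c: "\<And>v. v \<in> F \<Longrightarrow> c v \<in> lists \<T>"
      "\<And>u v. u \<in> F \<Longrightarrow> v \<in> F \<Longrightarrow> u \<in> \<Inter>(set (c v)) \<longleftrightarrow> u = v"
      by metis
    let ?f = "cell_index (map c xs)"
    have mono: "?f x < ?f y" if "x \<in> F" "y \<in> F" "(x, y) \<in> l" for x y
      using that xs c(2) lD(5) by (intro cell_index_strict_mono[OF xs(2)]) auto
    \<comment> \<open>On \<open>F\<close> the ranks are strictly increasing along \<open>l\<close>,
      so no ties occur there. Totality of \<open>l\<close> gives the converse direction.\<close>
    have "p \<in> lex_order V b ?f \<longleftrightarrow> p \<in> l" if p: "p \<in> K" for p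
    proof -
      obtain x y where xy: "p = (x, y)" by (cases p)
      have "x \<in> F" "y \<in> F" using p xy by (force simp: F_def)+
      moreover have "x \<in> V" "y \<in> V" "x \<noteq> y" using K(2) p xy by auto
      ultimately show ?thesis
        using mono[of x y] mono[of y x] lD(4)[of x y] xy by (auto simp: lex_order_def)
    qed
    then have "lex_order V b ?f \<in> U" by (intro K(3) lex_order_Lin[OF b]) auto
    moreover have "map c xs \<in> lists (lists \<T>)"
      using c(1) xs(1) unfolding in_lists_conv_set[of "map c xs"] by (metis imageE list.set_map)
    ultimately show ?thesis by blast
  qed
  then have "dense_subset (Lin_topology V) ?E"
    unfolding dense_subset_def dense_intersects_open using lex_order_Lin[OF b] by auto
  ultimately show ?thesis by blast
qed

section \<open>Point-separating families from dense subsets of an order\<close>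

lemma openin_interval_topology_between:
  assumes "x \<in> X" "y \<in> X"
  shows "openin (interval_topology X r) {z \<in> X. (x, z) \<in> r - Id \<and> (z, y) \<in> r - Id}"
proof -
  have "openin (interval_topology X r) {z \<in> X. (x, z) \<in> r - Id}"
    "openin (interval_topology X r) {z \<in> X. (z, y) \<in> r - Id}"
    unfolding interval_topology_def using assms
    by (auto intro!: topology_generated_by_Basis)
  then have "openin (interval_topology X r) ({z \<in> X. (x, z) \<in> r - Id} \<inter> {z \<in> X. (z, y) \<in> r - Id})"
    by (rule openin_Int)
  moreover have "{z \<in> X. (x, z) \<in> r - Id} \<inter> {z \<in> X. (z, y) \<in> r - Id}
      = {z \<in> X. (x, z) \<in> r - Id \<and> (z, y) \<in> r - Id}"
    by blast
  ultimately show ?thesis by (simp only:)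
qed

lemma separating_family_of_dense:
  fixes X :: "'x set"
  assumes X: "infinite X" "linear_order_on X r" and D: "dense_subset (interval_topology X r) D"
  shows "infinite D" "\<exists>\<T>. |\<T>| \<le>o |D| \<and>
    (\<forall>x\<in>X. \<forall>y\<in>X. x \<noteq> y \<longrightarrow> (\<exists>T\<in>\<T>. x \<in> T \<and> y \<notin> T))"
proof -
  define l where "l = r - Id"
  have "l \<in> Lin X" using X(2) by (auto simp: Lin_eq_diff_Id l_def)
  note l = LinD[OF this]
  have between: "\<exists>d\<in>D. (x, d) \<in> l \<and> (d, y) \<in> l" if "(x, z) \<in> l" "(z, y) \<in> l" for x y z
  proof -
    have "openin (interval_topology X r) {z \<in> X. (x, z) \<in> l \<and> (z, y) \<in> l}"
      unfolding l_def using that l(1) by (intro openin_interval_topology_between) auto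
    moreover have "z \<in> {z \<in> X. (x, z) \<in> l \<and> (z, y) \<in> l}" using that l(1) by auto
    ultimately have "D \<inter> {z \<in> X. (x, z) \<in> l \<and> (z, y) \<in> l} \<noteq> {}"
      using D unfolding dense_subset_def dense_intersects_open by blast
    then show ?thesis by blast
  qed
  \<comment> \<open>\<open>B\<close> consists of the points with an immediate predecessor, the upper
    ends of jumps.\<close>
  define B where "B = {x. \<exists>w. (w, x) \<in> l \<and> (\<forall>z. \<not> ((w, z) \<in> l \<and> (z, x) \<in> l))}"
  define S where "S = insert B ((\<lambda>d. {x. (d, x) \<in> l}) ` D)"
  \<comment> \<open>A member of \<open>S\<close> may distinguish two points in the wrong direction;
    its complement then serves.\<close>
  define \<T> where "\<T> = S \<union> uminus ` S"
  have sep_less: "\<exists>T\<in>S. (x \<in> T) \<noteq> (y \<in> T)" if xy: "(x, y) \<in> l" for x y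
  proof (rule ccontr)
    assume "\<not> ?thesis"
    then have B: "x \<in> B \<longleftrightarrow> y \<in> B" and d: "\<And>d. d \<in> D \<Longrightarrow> (d, x) \<in> l \<longleftrightarrow> (d, y) \<in> l"
      by (auto simp: S_def)
    have "x \<notin> D" using d[of x] xy l(2) by auto
    \<comment> \<open>A point between \<open>x\<close> and \<open>y\<close> would yield some
      \<open>d\<close> in \<open>D\<close> between them, whose upper ray contains \<open>y\<close>
      but not \<open>x\<close>.\<close>
    have gap: "\<not> ((x, z) \<in> l \<and> (z, y) \<in> l)" for z
      using between[of x z y] d l(5) by blast
    then have "x \<in> B" using B xy by (auto simp: B_def)
    then obtain w where w: "(w, x) \<in> l" "\<And>z. \<not> ((w, z) \<in> l \<and> (z, x) \<in> l)"
      by (auto simp: B_def)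
    \<comment> \<open>Now \<open>w\<close>, \<open>x\<close>, \<open>y\<close> are consecutive. The
      interval from \<open>w\<close> to \<open>y\<close> contains \<open>x\<close>, so it meets
      \<open>D\<close> in some \<open>e\<close>; since \<open>e\<close> lies below \<open>y\<close>,
      it also lies below \<open>x\<close>, inside the jump from \<open>w\<close> to
      \<open>x\<close>.\<close>
    obtain e where "e \<in> D" "(w, e) \<in> l" "(e, y) \<in> l" using between[OF w(1) xy] by blast
    then show False using d w(2) by blast
  qed
  have sep: "\<exists>T\<in>\<T>. x \<in> T \<and> y \<notin> T" if "x \<in> X" "y \<in> X" "x \<noteq> y" for x y
    using sep_less[of x y] sep_less[of y x] l(4)[OF that] unfolding \<T>_def by blast
  show inf: "infinite D"
  proof
    \<comment> \<open>Then the family would be finite, yet points of the infinite set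
      \<open>X\<close> are determined by the members containing them.\<close>
    assume "finite D"
    then have "finite (Pow \<T>)" by (simp add: \<T>_def S_def)
    moreover have "inj_on (\<lambda>x. {T \<in> \<T>. x \<in> T}) X"
    proof (rule inj_onI, rule ccontr)
      fix x y assume xy: "x \<in> X" "y \<in> X" "x \<noteq> y" and eq: "{T \<in> \<T>. x \<in> T} = {T \<in> \<T>. y \<in> T}"
      then obtain T where "T \<in> \<T>" "x \<in> T" "y \<notin> T" using sep by blast
      then show False using eq by blast
    qed
    ultimately have "finite X"
      using finite_subset[of "(\<lambda>x. {T \<in> \<T>. x \<in> T}) ` X" "Pow \<T>"] finite_imageD by blast
    then show False using X(1) by simp
  qed
  have union: "|A \<union> A'| \<le>o |D|" if "|A| \<le>o |D|" "|A'| \<le>o |D|" for A A' :: "'x set set"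
    by (rule card_of_Un_ordLeq_infinite_Field)
      (use inf that in \<open>simp_all only: Field_card_of card_of_card_order_on not_False_eq_True\<close>)
  have "|{B} \<union> (\<lambda>d. {x. (d, x) \<in> l}) ` D| \<le>o |D|"
    by (intro union card_of_image card_of_ordLeq_finite_infinite inf) simp
  then have S: "|S| \<le>o |D|" by (simp add: S_def)
  have "|uminus ` S| \<le>o |D|"
    by (rule ordLeq_transitive[OF card_of_image S])
  then have "|\<T>| \<le>o |D|"
    unfolding \<T>_def by (rule union[OF S])
  then show "\<exists>\<T>. |\<T>| \<le>o |D| \<and>
    (\<forall>x\<in>X. \<forall>y\<in>X. x \<noteq> y \<longrightarrow> (\<exists>T\<in>\<T>. x \<in> T \<and> y \<notin> T))"
    using sep by blast
qed

section \<open>The chain of inequalities\<close>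

lemma delta_attained:
  fixes \<kappa> :: "'k rel"
  assumes "Card_order \<kappa>"
  obtains X :: "'k set" and r D where "|X| =o \<kappa>" "linear_order_on X r"
    "dense_subset (interval_topology X r) D" "|D| =o delta \<kappa>"
proof -
  let ?P = "\<lambda>\<mu> :: 'k rel. \<exists>(X :: 'k set) r D. |X| =o \<kappa> \<and> linear_order_on X r
     \<and> dense_subset (interval_topology X r) D \<and> |D| =o \<mu>"
  \<comment> \<open>Some admissible cardinal is needed before the minimum can be used: \<kappa>
    orders its own field, and the whole field is dense.\<close>
  have "linear_order_on (Field \<kappa>) \<kappa>"
    using assms by (simp add: card_order_on_def well_order_on_def)
  moreover have "dense_subset (interval_topology (Field \<kappa>) \<kappa>) (Field \<kappa>)"
    using closure_of_topspace[of "interval_topology (Field \<kappa>) \<kappa>"] by (simp add: dense_subset_def)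
  ultimately have "?P \<kappa>" using card_of_Field_ordIso[OF assms] by blast
  from least_cardinal_props(2)[of \<kappa> ?P, OF assms this, folded delta_def] that
  show ?thesis by blast
qed

theorem theorem4:
  fixes \<kappa> :: "'k rel" and V :: "'a set"
  assumes "Cinfinite \<kappa>" and "|V| =o \<kappa>"
  shows "log2 \<kappa> \<le>o h_Lin V
    \<and> h_Lin V \<le>o density_character (Lin_topology V)
    \<and> density_character (Lin_topology V) \<le>o delta \<kappa>"
proof -
  have \<kappa>: "Card_order \<kappa>" using assms(1) by simp
  have inf: "infinite A" if "|A| =o \<kappa>" for A :: "'c set"
    using assms(1) that Cinfinite_cong[of \<kappa> "|A|"] ordIso_symmetric
    by (auto simp: cinfinite_def Field_card_of)
  let ?H = "\<lambda>\<mu>. \<exists>F. F \<subseteq> Lin V \<and> separates_pairs V F \<and> |F| =o \<mu>"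
  let ?D = "\<lambda>\<mu>. \<exists>D. dense_subset (Lin_topology V) D \<and> |D| =o \<mu>"
  have dens: "?D |D|" if "dense_subset (Lin_topology V) D" for D
    using that by (blast intro: card_of_refl)
  have all: "dense_subset (Lin_topology V) (Lin V)"
    using closure_of_topspace[of "Lin_topology V"] by (simp add: dense_subset_def)
  have d: "Card_order (density_character (Lin_topology V))" "?D (density_character (Lin_topology V))"
    using least_cardinal_props(1,2)[of "|Lin V|" ?D, folded density_character_def] dens[OF all]
      card_of_Card_order by blast+
  \<comment> \<open>This gives the second inequality and also shows that the minimum defining
    \<open>h_Lin V\<close> is attained.\<close>
  have H: "?H (density_character (Lin_topology V))"
    using d(2) dense_separates_pairs by blast
  note h = least_cardinal_props[of _ ?H, OF d(1) H, folded h_Lin_def]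
  obtain F where F: "separates_pairs V F" "|F| =o h_Lin V" using h(2) by blast
  have "\<kappa> \<le>o ctwo ^c |F|"
    using card_of_le_ctwo_cexp_separating[OF inf[OF assms(2)] F(1)] assms(2)
      ordIso_symmetric ordIso_ordLeq_trans by blast
  then have "log2 \<kappa> \<le>o |F|" by (intro log2_props(3)[OF \<kappa>] card_of_Card_order)
  then have 1: "log2 \<kappa> \<le>o h_Lin V" using F(2) by (rule ordLeq_ordIso_trans)
  have 2: "h_Lin V \<le>o density_character (Lin_topology V)" by (rule h(3)[OF d(1) H])
  obtain X :: "'k set" and r D where X: "|X| =o \<kappa>" "linear_order_on X r"
    "dense_subset (interval_topology X r) D" "|D| =o delta \<kappa>"
    using delta_attained[OF \<kappa>] .
  have "|V| =o |X|" using assms(2) X(1) ordIso_symmetric ordIso_transitive by blast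
  then obtain g where g: "bij_betw g V X" using card_of_ordIso by blast
  note fam = separating_family_of_dense[OF inf[OF X(1)] X(2,3)]
  obtain \<T> where T: "|\<T>| \<le>o |D|"
    "\<And>x y. x \<in> X \<Longrightarrow> y \<in> X \<Longrightarrow> x \<noteq> y \<Longrightarrow> \<exists>T\<in>\<T>. x \<in> T \<and> y \<notin> T"
    using fam(2) by blast
  \<comment> \<open>Only the separating family is carried from \<open>X\<close> to \<open>V\<close>,
    by preimages under the bijection \<open>g\<close>; the infinite set \<open>D\<close> bounds the
    cardinality.\<close>
  have "\<exists>E. dense_subset (Lin_topology V) E \<and> |E| \<le>o |D|"
  proof (rule dense_Lin_of_separating_family[OF fam(1)])
    show "|vimage g ` \<T>| \<le>o |D|" using card_of_image T(1) ordLeq_transitive by blast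
    fix x y assume "x \<in> V" "y \<in> V" "x \<noteq> y"
    then have "\<exists>T\<in>\<T>. g x \<in> T \<and> g y \<notin> T"
      using g by (intro T(2)) (auto simp: bij_betw_def dest: inj_onD)
    then show "\<exists>T\<in>vimage g ` \<T>. x \<in> T \<and> y \<notin> T" by blast
  qed
  then obtain E where E: "dense_subset (Lin_topology V) E" "|E| \<le>o |D|" by blast
  have "density_character (Lin_topology V) \<le>o |E|"
    unfolding density_character_def
    by (rule least_cardinal_props(3)[of "|E|"]) (use dens[OF E(1)] in \<open>simp_all add: card_of_Card_order\<close>)
  then have "density_character (Lin_topology V) \<le>o delta \<kappa>"
    using E(2) X(4) ordLeq_transitive ordLeq_ordIso_trans by blast
  with 1 2 show ?thesis by blast
qed

end
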